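(* Let $(X,\rho)$ be a metric space with a positive $\sigma$-finite Borel measure $dx$, fix $x_0\in X$, and let $B_r=\{x\in X:\rho(x,x_0)<r\}$. Let $1\le p<\infty$ and let $\phi$ be a radially decreasing weight with $\phi=\Phi(\rho(\cdot,x_0))$. Let $F:L^p(X)\times(\tfrac12,1]\to[0,\infty]$ be a functional satisfying $$F(u+a,r)=F(u,r),\quad a\in\mathbb{R},$$ $$\int_{B_r}|u(x)-u_{B_r}|^p\,dx\le F(u,r),$$ for every $r\in(\tfrac12,1]$ and every $u\in L^p(X)$. Then for $M=\frac{8^p|B_1|}{|B_{1/2}|}\,\frac{\Phi(0)}{\Phi(1/2)}$, $$\int_{B_1}|u(x)-u_{B_1}^\phi|^p\,\phi(x)\,dx\le M\int_{1/2}^1 F(u,t)\,\nu(dt)$$ for every $u\in L^p(B_1)$, where $\nu$ is the measure on $(\tfrac12,1]$ associated with $\phi$ as described in the context.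
   Context: $|E|=\int_E dx$ is the measure of a Borel set $E\subset X$, and $\overline{B}_r=\{x\in X:\rho(x,x_0)\le r\}$. A function $\phi:B_1\to[0,\infty)$ is called a radially decreasing weight if $\phi$ is radial, i.e. $\phi=\Phi(\rho(\cdot,x_0))$, and its profile $\Phi$ is nonincreasing and right-continuous with left limits; it is assumed that $\phi$ is not identically zero on $B_1\setminus\overline{B}_{1/2}$. For any such weight there exists a positive, non-zero $\sigma$-finite Borel measure $\nu$ on $(\tfrac12,1]$ such that $$\phi(x)=\int_{\rho(x,x_0)\vee 1/2}^1\nu(dt)=\int_{1/2}^1\chi_{B_t}(x)\,\nu(dt),\quad x\in B_1\setminus\overline{B}_{1/2};$$ this is the $\nu$ in the claim. Here $\int_a^b f(t)\,\nu(dt)$ means $\int_{(a,b]}f(t)\,\nu(dt)$, $a\vee b=\max(a,b)$, and $\chi_E$ is the indicator function of $E$. The means are $u_E=\frac1{|E|}\int_E u(x)\,dx$ and, for $E\subset B_1$, $u_E^\phi=\frac{\int_E u(x)\phi(x)\,dx}{\int_E\phi(x)\,dx}$.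
   Formalization: The measure ν is also required to satisfy ν((1/2,1]) = Φ(1/2), since if no points lie at distances just above 1/2 the formula on the annulus does not fix ν and the claim can fail; also 0<|B_{1/2}| and |B_1|<∞ are assumed so that the means and M make sense. *)

theory Defs
  imports "HOL-Analysis.Analysis"
begin

text \<open>
  Elements of \<open>L\<^sup>p\<close> are represented by functions rather than by classes modulo null sets.
  Functions are total, so \<open>u \<in> Lp_on \<mu> p S\<close> says nothing about \<open>u\<close> outside \<open>S\<close>.
\<close>

definition Lp_on :: "'a measure \<Rightarrow> real \<Rightarrow> 'a set \<Rightarrow> ('a \<Rightarrow> real) set" where
  "Lp_on \<mu> p S =
    {u. set_borel_measurable \<mu> S u \<and> set_integrable \<mu> S (\<lambda>x. \<bar>u x\<bar> powr p)}"

definition mean_on :: "'a measure \<Rightarrow> 'a set \<Rightarrow> ('a \<Rightarrow> real) \<Rightarrow> real" where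
  "mean_on \<mu> E u = (1 / measure \<mu> E) * (LINT x:E|\<mu>. u x)"

definition weighted_mean_on ::
    "'a measure \<Rightarrow> ('a \<Rightarrow> real) \<Rightarrow> 'a set \<Rightarrow> ('a \<Rightarrow> real) \<Rightarrow> real" where
  "weighted_mean_on \<mu> \<phi> E u = (LINT x:E|\<mu>. u x * \<phi> x) / (LINT x:E|\<mu>. \<phi> x)"

text \<open>
  A weight lives on the unit ball and its profile on \<open>[0, 1)\<close>; the values of the total functions
  \<open>\<phi>\<close> and \<open>\<Phi>\<close> elsewhere are irrelevant.
\<close>

definition radially_decreasing_weight ::
    "'a::metric_space \<Rightarrow> ('a \<Rightarrow> real) \<Rightarrow> (real \<Rightarrow> real) \<Rightarrow> bool" where
  "radially_decreasing_weight x0 \<phi> \<Phi> \<longleftrightarrow>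
    (\<forall>x\<in>ball x0 1. \<phi> x = \<Phi> (dist x x0)) \<and>
    (\<forall>s\<in>{0..<1}. 0 \<le> \<Phi> s) \<and>
    antimono_on {0..<1} \<Phi> \<and>
    (\<forall>s\<in>{0..<1}. continuous (at_right s) \<Phi>) \<and>
    (\<forall>s\<in>{0<..<1}. \<exists>l. (\<Phi> \<longlongrightarrow> l) (at_left s)) \<and>
    (\<exists>x\<in>ball x0 1 - cball x0 (1/2). \<phi> x \<noteq> 0)"

text \<open>
  The last conjunct is the representation formula at radius \<open>1/2\<close>. By right-continuity of \<open>\<Phi>\<close> it
  follows from the formula on the annulus whenever the distances to \<open>x0\<close> accumulate at \<open>1/2\<close> from
  above. It cannot be dropped in general: if no point has distance to \<open>x0\<close> in \<open>(1/2, 3/4)\<close>, the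
  formula on the annulus does not bound the total mass of \<open>\<nu>\<close> below in terms of \<open>\<Phi> (1/2)\<close>.
\<close>

definition representing_measure ::
    "'a::metric_space \<Rightarrow> ('a \<Rightarrow> real) \<Rightarrow> (real \<Rightarrow> real) \<Rightarrow> real measure \<Rightarrow> bool" where
  "representing_measure x0 \<phi> \<Phi> \<nu> \<longleftrightarrow>
    sets \<nu> = sets (restrict_space borel {1/2<..1}) \<and>
    sigma_finite_measure \<nu> \<and>
    emeasure \<nu> (space \<nu>) \<noteq> 0 \<and>
    (\<forall>x\<in>ball x0 1 - cball x0 (1/2).
       ennreal (\<phi> x) = emeasure \<nu> {max (dist x x0) (1/2)<..1}) \<and>
    ennreal (\<Phi> (1/2)) = emeasure \<nu> {1/2<..1}"

lemma representing_measure_indicator: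
  assumes "representing_measure x0 \<phi> \<Phi> \<nu>" and x: "x \<in> ball x0 1 - cball x0 (1/2)"
  shows "ennreal (\<phi> x) = (\<integral>\<^sup>+t. indicator (ball x0 t) x \<partial>\<nu>)"
proof -
  have sets: "sets \<nu> = sets (restrict_space borel {1/2<..1})"
    and eq: "ennreal (\<phi> x) = emeasure \<nu> {max (dist x x0) (1/2)<..1}"
    using assms by (auto simp: representing_measure_def)
  have sp: "space \<nu> = {1/2<..1}"
    using sets_eq_imp_space_eq[OF sets] by simp
  have "(\<integral>\<^sup>+t. indicator (ball x0 t) x \<partial>\<nu>)
      = (\<integral>\<^sup>+t. indicator {max (dist x x0) (1/2)<..1} t \<partial>\<nu>)"
    by (rule nn_integral_cong) (auto simp: sp indicator_def dist_commute)
  also have "\<dots> = emeasure \<nu> {max (dist x x0) (1/2)<..1}"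
    by (rule nn_integral_indicator) (auto simp: sets sets_restrict_space_iff)
  finally show ?thesis
    using eq by simp
qed

lemma representing_measure_exists:
  assumes "radially_decreasing_weight x0 \<phi> \<Phi>"
  shows "\<exists>\<nu>. representing_measure x0 \<phi> \<Phi> \<nu>"
proof -
  note w = assms[unfolded radially_decreasing_weight_def]
  have rad: "\<phi> x = \<Phi> (dist x x0)" if "x \<in> ball x0 1" for x
    using w that by blast
  have nonneg: "0 \<le> \<Phi> s" if "0 \<le> s" "s < 1" for s
    using w that by auto
  have anti: "\<Phi> t \<le> \<Phi> s" if "0 \<le> s" "s \<le> t" "t < 1" for s t
    using w that by (auto simp: monotone_on_def)
  have rc: "continuous (at_right s) \<Phi>" if "0 \<le> s" "s < 1" for s
    using w that by auto
  obtain y where y: "y \<in> ball x0 1 - cball x0 (1/2)" "\<phi> y \<noteq> 0"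
    using w by blast
  have pos: "0 < \<Phi> (1/2)"
  proof -
    have "0 < \<Phi> (dist y x0)"
      using y rad[of y] nonneg[of "dist y x0"] by (auto simp: dist_commute less_le)
    also have "\<dots> \<le> \<Phi> (1/2)"
      using y by (intro anti) (auto simp: dist_commute)
    finally show ?thesis .
  qed
  define G where "G t = (if t < 1 then - \<Phi> (max t (1/2)) else 0)" for t
  have G_mono: "G a \<le> G b" if "a \<le> b" for a b
    using that by (auto simp: G_def intro!: anti nonneg)
  have G_rc: "continuous (at_right a) G" for a
  proof -
    consider "a < 1/2" | "1/2 \<le> a" "a < 1" | "1 \<le> a" by linarith
    then show ?thesis
    proof cases
      case 1
      have "eventually (\<lambda>t. G t = G a) (at_right a)"
        using 1 by (auto simp: eventually_at_right_field G_def max_def intro!: exI[of _ "1/2"])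
      then show ?thesis
        by (simp add: continuous_within tendsto_eventually)
    next
      case 2
      have "((\<lambda>t. - \<Phi> t) \<longlongrightarrow> - \<Phi> a) (at_right a)"
        using rc[of a] 2 by (intro tendsto_minus) (simp add: continuous_within)
      moreover have "eventually (\<lambda>t. - \<Phi> t = G t) (at_right a)"
        using 2 by (auto simp: eventually_at_right_field G_def max_def intro!: exI[of _ 1])
      ultimately have "(G \<longlongrightarrow> - \<Phi> a) (at_right a)"
        by (rule Lim_transform_eventually)
      moreover have "G a = - \<Phi> a"
        using 2 by (simp add: G_def max_absorb1)
      ultimately show ?thesis
        by (simp add: continuous_within)
    next
      case 3
      have "eventually (\<lambda>t. G t = G a) (at_right a)"
        using 3 by (auto simp: eventually_at_right_field G_def intro!: exI[of _ "a + 1"])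
      then show ?thesis
        by (simp add: continuous_within tendsto_eventually)
    qed
  qed
  define \<nu> where "\<nu> = restrict_space (interval_measure G) {1/2<..1}"
  have em: "emeasure \<nu> {s<..1} = ennreal (\<Phi> s)" if "1/2 \<le> s" "s < 1" for s
  proof -
    have "emeasure \<nu> {s<..1} = emeasure (interval_measure G) {s<..1}"
      unfolding \<nu>_def using that by (intro emeasure_restrict_space) auto
    also have "\<dots> = ennreal (G 1 - G s)"
      using that by (intro emeasure_interval_measure_Ioc G_mono G_rc) auto
    finally show ?thesis
      using that by (simp add: G_def max_absorb1)
  qed
  have sets: "sets \<nu> = sets (restrict_space borel {1/2<..1})"
    unfolding \<nu>_def by (intro sets_restrict_space_cong) simp
  have sp: "space \<nu> = {1/2<..1}"
    using sets_eq_imp_space_eq[OF sets] by simp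
  have "finite_measure \<nu>"
    by (rule finite_measureI) (simp add: sp em)
  then have "sigma_finite_measure \<nu>"
    by (simp add: finite_measure.axioms(1))
  moreover have "ennreal (\<phi> x) = emeasure \<nu> {max (dist x x0) (1/2)<..1}"
    if "x \<in> ball x0 1 - cball x0 (1/2)" for x
    using that rad[of x] em[of "dist x x0"] by (auto simp: dist_commute max_def)
  ultimately show ?thesis
    using sets pos em[of "1/2"] by (auto simp: representing_measure_def sp)
qed

end

theory Submission
  imports Defs
begin

text \<open>
  Compare \<open>u\<close> with the constant \<open>c = u_{B_{1/2}}\<close>. Replacing the \<open>\<phi>\<close>-mean by \<open>c\<close> costs a factor
  \<open>2\<^sup>p\<close>. On \<open>B_1\<close>, \<open>\<phi>\<close> is at most \<open>\<Phi>(0)/\<Phi>(1/2)\<close> times the superposition of the indicators of the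
  balls \<open>B_t\<close> against \<open>\<nu>\<close>, so by Tonelli it suffices to bound the integral of \<open>|u - c|\<^sup>p\<close> over each
  \<open>B_t\<close>; since \<open>B_{1/2} \<subseteq> B_t\<close>, replacing \<open>c\<close> by the mean over \<open>B_t\<close> there costs a factor
  \<open>2\<^sup>p |B_1|/|B_{1/2}|\<close>. The total is \<open>4\<^sup>p\<close> in place of \<open>8\<^sup>p\<close>.
\<close>

lemma powr_tangent_le:
  fixes y m p :: real
  assumes "1 \<le> p" "0 \<le> y" "0 \<le> m"
  shows "m powr p + p * m powr (p - 1) * (y - m) \<le> y powr p"
proof (cases "y = 0 \<or> m = 0")
  case True
  have "m powr (p - 1) * m = m powr p"
    using assms by (cases "m = 0") (simp_all add: powr_mult_base mult.commute)
  then have "m powr p + p * m powr (p - 1) * (0 - m) = (1 - p) * m powr p"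
    by (simp add: algebra_simps)
  also have "\<dots> \<le> 0"
    using assms by (simp add: mult_nonpos_nonneg)
  finally show ?thesis
    using True assms by auto
next
  case False
  then have "(y powr p) powr (1/p) * (m powr p) powr (1 - 1/p) \<le> 1/p * y powr p + (1 - 1/p) * m powr p"
    using assms by (intro Youngs_inequality_0) auto
  moreover have "(y powr p) powr (1/p) = y"
    using assms by (simp add: powr_powr)
  moreover have exponent: "p * (1 - 1/p) = p - 1"
    using assms by (simp add: field_simps)
  then have "(m powr p) powr (1 - 1/p) = m powr (p - 1)"
    by (simp only: powr_powr)
  ultimately have "p * (y * m powr (p - 1)) \<le> p * (1/p * y powr p + (1 - 1/p) * m powr p)"
    using assms by (intro mult_left_mono) auto
  also have "\<dots> = y powr p + (p * (1 - 1/p)) * m powr p"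
    using assms by (simp add: distrib_left)
  finally have "p * (y * m powr (p - 1)) \<le> y powr p + (p - 1) * m powr p"
    by (simp only: exponent)
  moreover have "m powr (p - 1) * m = m powr p"
    using assms False by (simp add: powr_mult_base mult.commute)
  ultimately show ?thesis
    by (simp add: algebra_simps)
qed

lemma add_powr_le:
  fixes a b p :: real
  assumes "1 \<le> p" "0 \<le> a" "0 \<le> b"
  shows "(a + b) powr p \<le> 2 powr (p - 1) * (a powr p + b powr p)"
proof -
  define m where "m = (a + b) / 2"
  have ab: "a + b = 2 * m" by (simp add: m_def)
  have m: "0 \<le> m" using assms by (simp add: m_def)
  have "2 * m powr p + p * m powr (p - 1) * (a + b - 2 * m) \<le> a powr p + b powr p"
    using powr_tangent_le[OF assms(1,2) m] powr_tangent_le[OF assms(1,3) m]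
    by (simp add: algebra_simps)
  then have "2 * m powr p \<le> a powr p + b powr p"
    by (simp add: ab)
  moreover have "(a + b) powr p = 2 powr (p - 1) * (2 * m powr p)"
    using assms by (simp add: m_def powr_divide powr_diff)
  ultimately show ?thesis
    by (simp add: mult_left_mono)
qed

lemma abs_diff_powr_le:
  fixes a b c p :: real
  assumes "1 \<le> p"
  shows "\<bar>a - b\<bar> powr p \<le> 2 powr (p - 1) * (\<bar>a - c\<bar> powr p + \<bar>c - b\<bar> powr p)"
proof -
  have "\<bar>a - b\<bar> powr p \<le> (\<bar>a - c\<bar> + \<bar>c - b\<bar>) powr p"
    using assms by (intro powr_mono2) auto
  also have "\<dots> \<le> 2 powr (p - 1) * (\<bar>a - c\<bar> powr p + \<bar>c - b\<bar> powr p)"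
    using assms by (intro add_powr_le) auto
  finally show ?thesis .
qed

context
  fixes M :: "'a measure" and f w :: "'a \<Rightarrow> real" and p :: real
  assumes p: "1 \<le> p"
    and f [measurable]: "f \<in> borel_measurable M"
    and w [measurable]: "w \<in> borel_measurable M"
    and w_nonneg: "\<And>x. 0 \<le> w x"
    and w_int: "integrable M w"
    and fp_int: "integrable M (\<lambda>x. \<bar>f x\<bar> powr p * w x)"
begin

lemma integrable_weighted: "integrable M (\<lambda>x. f x * w x)"
proof (rule Bochner_Integration.integrable_bound)
  show "integrable M (\<lambda>x. w x + \<bar>f x\<bar> powr p * w x)"
    using w_int fp_int by simp
  have "\<bar>f x\<bar> * w x \<le> w x + \<bar>f x\<bar> powr p * w x" for x
  proof -
    have "\<bar>f x\<bar> \<le> 1 + \<bar>f x\<bar> powr p"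
    proof (cases "\<bar>f x\<bar> \<le> 1")
      case False
      then have "\<bar>f x\<bar> powr 1 \<le> \<bar>f x\<bar> powr p"
        using p by (intro powr_mono) auto
      then show ?thesis by simp
    qed (simp add: add_increasing2)
    from mult_right_mono[OF this w_nonneg[of x]] show ?thesis
      by (simp add: algebra_simps)
  qed
  then show "AE x in M. norm (f x * w x) \<le> norm (w x + \<bar>f x\<bar> powr p * w x)"
    by (intro AE_I2) (simp add: abs_mult w_nonneg)
qed simp

lemma integrable_diff_powr_weighted: "integrable M (\<lambda>x. \<bar>f x - a\<bar> powr p * w x)"
proof (rule Bochner_Integration.integrable_bound)
  show "integrable M (\<lambda>x. 2 powr (p - 1) * (\<bar>f x\<bar> powr p * w x + \<bar>a\<bar> powr p * w x))"
    using w_int fp_int by simp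
  have "\<bar>f x - a\<bar> powr p * w x \<le> 2 powr (p - 1) * (\<bar>f x\<bar> powr p * w x + \<bar>a\<bar> powr p * w x)" for x
    using mult_right_mono[OF abs_diff_powr_le[OF p, of "f x" a 0] w_nonneg[of x]]
    by (simp add: algebra_simps)
  then show "AE x in M. norm (\<bar>f x - a\<bar> powr p * w x)
      \<le> norm (2 powr (p - 1) * (\<bar>f x\<bar> powr p * w x + \<bar>a\<bar> powr p * w x))"
    by (intro AE_I2) (simp add: abs_mult w_nonneg)
qed simp

lemma weighted_mean_powr_le:
  "\<bar>(\<integral>x. f x * w x \<partial>M) / (\<integral>x. w x \<partial>M)\<bar> powr p * (\<integral>x. w x \<partial>M)
    \<le> (\<integral>x. \<bar>f x\<bar> powr p * w x \<partial>M)"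
proof -
  define W where "W = (\<integral>x. w x \<partial>M)"
  define m where "m = \<bar>(\<integral>x. f x * w x \<partial>M) / W\<bar>"
  have W: "0 \<le> W"
    unfolding W_def by (simp add: w_nonneg)
  have abs_int: "integrable M (\<lambda>x. \<bar>f x\<bar> * w x)"
    using integrable_abs[OF integrable_weighted] by (simp add: abs_mult w_nonneg)
  have "m * W \<le> (\<integral>x. \<bar>f x\<bar> * w x \<partial>M)"
  proof -
    have "m * W \<le> \<bar>\<integral>x. f x * w x \<partial>M\<bar>"
      using W by (simp add: m_def abs_divide)
    also have "\<dots> \<le> (\<integral>x. \<bar>f x * w x\<bar> \<partial>M)"
      by (rule integral_abs_bound)
    finally show ?thesis
      by (simp add: abs_mult w_nonneg)
  qed
  then have "m powr p * W \<le> m powr p * W + p * m powr (p - 1) * ((\<integral>x. \<bar>f x\<bar> * w x \<partial>M) - m * W)"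
    using p by simp
  also have "\<dots> = (\<integral>x. m powr p * w x + p * m powr (p - 1) * (\<bar>f x\<bar> * w x - m * w x) \<partial>M)"
    using w_int abs_int by (simp add: W_def)
  also have "\<dots> \<le> (\<integral>x. \<bar>f x\<bar> powr p * w x \<partial>M)"
  proof (rule integral_mono)
    fix x
    have "0 \<le> m" by (simp add: m_def)
    from mult_right_mono[OF powr_tangent_le[OF p abs_ge_zero this, of "f x"] w_nonneg[of x]]
    show "m powr p * w x + p * m powr (p - 1) * (\<bar>f x\<bar> * w x - m * w x) \<le> \<bar>f x\<bar> powr p * w x"
      by (simp add: algebra_simps)
  qed (use w_int abs_int fp_int in simp_all)
  finally show ?thesis
    by (simp add: W_def m_def)
qed

end

lemma weighted_oscillation_le:
  fixes f w w' :: "'a \<Rightarrow> real" and a p :: real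
  assumes p: "1 \<le> p"
    and f [measurable]: "f \<in> borel_measurable M"
    and w [measurable]: "w \<in> borel_measurable M"
    and w' [measurable]: "w' \<in> borel_measurable M"
    and w'_nonneg: "\<And>x. 0 \<le> w' x" and w'_le: "\<And>x. w' x \<le> w x"
    and w_int: "integrable M w"
    and fp_int: "integrable M (\<lambda>x. \<bar>f x\<bar> powr p * w x)"
    and w'_pos: "0 < (\<integral>x. w' x \<partial>M)"
  defines "m \<equiv> (\<integral>x. f x * w' x \<partial>M) / (\<integral>x. w' x \<partial>M)"
  shows "(\<integral>x. \<bar>f x - m\<bar> powr p * w x \<partial>M)
    \<le> 2 powr p * ((\<integral>x. w x \<partial>M) / (\<integral>x. w' x \<partial>M)) * (\<integral>x. \<bar>f x - a\<bar> powr p * w x \<partial>M)"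
proof -
  define W where "W = (\<integral>x. w x \<partial>M)"
  define W' where "W' = (\<integral>x. w' x \<partial>M)"
  define J where "J = (\<integral>x. \<bar>f x - a\<bar> powr p * w x \<partial>M)"
  have w_nonneg: "0 \<le> w x" for x
    using w'_nonneg w'_le order_trans by blast
  have w'_int: "integrable M w'"
    by (rule Bochner_Integration.integrable_bound[OF w_int]) (simp_all add: w'_nonneg w'_le w_nonneg)
  have fp'_int: "integrable M (\<lambda>x. \<bar>f x\<bar> powr p * w' x)"
    by (rule Bochner_Integration.integrable_bound[OF fp_int])
      (simp_all add: w'_nonneg w_nonneg abs_mult w'_le mult_left_mono)
  note int = integrable_diff_powr_weighted[OF p f w w_nonneg w_int fp_int]
  note int' = integrable_diff_powr_weighted[OF p f w' w'_nonneg w'_int fp'_int]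
  have W'_pos: "0 < W'" and "W' \<le> W"
    unfolding W'_def W_def using w'_pos w'_int w_int w'_le by (auto intro: integral_mono)
  have J: "0 \<le> J"
    unfolding J_def by (simp add: w_nonneg)
  have "(\<integral>x. (f x - a) * w' x \<partial>M) = (\<integral>x. f x * w' x - a * w' x \<partial>M)"
    by (simp add: algebra_simps)
  also have "\<dots> = (\<integral>x. f x * w' x \<partial>M) - a * W'"
    unfolding W'_def using w'_int integrable_weighted[OF p f w' w'_nonneg w'_int fp'_int] by simp
  finally have "(\<integral>x. (f x - a) * w' x \<partial>M) / W' = m - a"
    using W'_pos by (simp add: m_def W'_def[symmetric] field_simps)
  then have "\<bar>m - a\<bar> powr p * W' \<le> (\<integral>x. \<bar>f x - a\<bar> powr p * w' x \<partial>M)"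
    using weighted_mean_powr_le[OF p _ w' w'_nonneg w'_int int', of a] by (simp add: W'_def)
  also have "\<dots> \<le> J"
    unfolding J_def by (intro integral_mono int int' mult_left_mono w'_le) simp
  finally have m: "\<bar>a - m\<bar> powr p \<le> J / W'"
    using W'_pos by (simp add: field_simps abs_minus_commute)
  have "(\<integral>x. \<bar>f x - m\<bar> powr p * w x \<partial>M)
      \<le> (\<integral>x. 2 powr (p - 1) * (\<bar>f x - a\<bar> powr p * w x + \<bar>a - m\<bar> powr p * w x) \<partial>M)"
  proof (rule integral_mono)
    fix x
    show "\<bar>f x - m\<bar> powr p * w x
        \<le> 2 powr (p - 1) * (\<bar>f x - a\<bar> powr p * w x + \<bar>a - m\<bar> powr p * w x)"
      using mult_right_mono[OF abs_diff_powr_le[OF p, of "f x" m a] w_nonneg[of x]]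
      by (simp add: algebra_simps)
  qed (use int w_int in simp_all)
  also have "\<dots> = 2 powr (p - 1) * (J + \<bar>a - m\<bar> powr p * W)"
    using int w_int by (simp add: J_def W_def)
  also have "\<dots> \<le> 2 powr (p - 1) * (J * (W / W') + J / W' * W)"
  proof (intro mult_left_mono add_mono mult_right_mono m)
    show "J \<le> J * (W / W')"
      using J W'_pos \<open>W' \<le> W\<close> mult_left_mono[of 1 "W / W'" J] by simp
  qed (use W'_pos \<open>W' \<le> W\<close> in auto)
  also have "\<dots> = 2 powr p * (W / W') * J"
    by (simp add: powr_diff)
  finally show ?thesis
    by (simp add: W_def W'_def J_def)
qed

lemma nn_set_integral_eq_integral:
  assumes "integrable M (\<lambda>x. g x * indicator A x)" "\<And>x. 0 \<le> g x"
  shows "(\<integral>\<^sup>+x\<in>A. ennreal (g x) \<partial>M) = ennreal (\<integral>x. g x * indicator A x \<partial>M)"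
proof -
  have "(\<integral>\<^sup>+x\<in>A. ennreal (g x) \<partial>M) = (\<integral>\<^sup>+x. ennreal (g x * indicator A x) \<partial>M)"
    by (intro nn_integral_cong) (simp add: indicator_def)
  then show ?thesis
    using assms by (simp add: nn_integral_eq_integral)
qed

lemma set_oscillation_le:
  fixes v :: "'a \<Rightarrow> real"
  assumes p: "1 \<le> p"
    and v: "v \<in> Lp_on M p UNIV"
    and A [measurable]: "A \<in> sets M" and A_fin: "emeasure M A < \<infinity>"
    and B [measurable]: "B \<in> sets M" and "B \<subseteq> A" and B_pos: "0 < measure M B"
  shows "(\<integral>\<^sup>+x\<in>A. ennreal (\<bar>v x - mean_on M B v\<bar> powr p) \<partial>M)
    \<le> ennreal (2 powr p * (measure M A / measure M B))
        * (\<integral>\<^sup>+x\<in>A. ennreal (\<bar>v x - a\<bar> powr p) \<partial>M)"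
proof -
  have v_meas [measurable]: "v \<in> borel_measurable M" and vp: "integrable M (\<lambda>x. \<bar>v x\<bar> powr p)"
    using v by (simp_all add: Lp_on_def set_borel_measurable_def set_integrable_def)
  define w :: "'a \<Rightarrow> real" where "w = indicator A"
  have w_meas [measurable]: "w \<in> borel_measurable M" by (simp add: w_def)
  have w_int: "integrable M w"
    using A A_fin by (simp add: w_def)
  have fp_int: "integrable M (\<lambda>x. \<bar>v x\<bar> powr p * w x)"
    unfolding w_def using vp by (rule integrable_real_mult_indicator[OF A])
  have int: "integrable M (\<lambda>x. \<bar>v x - b\<bar> powr p * w x)" for b
    by (rule integrable_diff_powr_weighted[OF p v_meas w_meas _ w_int fp_int]) (simp add: w_def)
  have nn: "(\<integral>\<^sup>+x\<in>A. ennreal (\<bar>v x - b\<bar> powr p) \<partial>M) = ennreal (\<integral>x. \<bar>v x - b\<bar> powr p * w x \<partial>M)" for b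
    using int[of b] unfolding w_def by (rule nn_set_integral_eq_integral) simp
  have B_le: "indicator B x \<le> w x" for x
    using \<open>B \<subseteq> A\<close> by (auto simp: w_def indicator_def)
  have "mean_on M B v = (\<integral>x. v x * indicator B x \<partial>M) / (\<integral>x. indicator B x \<partial>M)"
    by (simp add: mean_on_def set_lebesgue_integral_def mult.commute)
  then have "(\<integral>x. \<bar>v x - mean_on M B v\<bar> powr p * w x \<partial>M)
      \<le> 2 powr p * ((\<integral>x. w x \<partial>M) / (\<integral>x. indicator B x \<partial>M)) * (\<integral>x. \<bar>v x - a\<bar> powr p * w x \<partial>M)"
    using weighted_oscillation_le[OF p v_meas w_meas _ _ B_le w_int fp_int, of a] B_pos by simp
  then have "(\<integral>x. \<bar>v x - mean_on M B v\<bar> powr p * w x \<partial>M)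
      \<le> 2 powr p * (measure M A / measure M B) * (\<integral>x. \<bar>v x - a\<bar> powr p * w x \<partial>M)"
    by (simp add: w_def)
  then show ?thesis
    unfolding nn by (subst ennreal_mult[symmetric]) (auto intro!: ennreal_leI simp: w_def)
qed

lemma radially_decreasing_weight_bounds:
  assumes w: "radially_decreasing_weight x0 \<phi> \<Phi>"
  shows "\<And>x. x \<in> ball x0 1 \<Longrightarrow> 0 \<le> \<phi> x \<and> \<phi> x \<le> \<Phi> 0"
    and "\<And>x. x \<in> ball x0 (1/2) \<Longrightarrow> \<Phi> (1/2) \<le> \<phi> x"
    and "0 < \<Phi> (1/2)" "\<Phi> (1/2) \<le> \<Phi> 0"
proof -
  note w' = w[unfolded radially_decreasing_weight_def]
  have rad: "\<phi> x = \<Phi> (dist x x0)" if "x \<in> ball x0 1" for x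
    using w' that by blast
  have nonneg: "0 \<le> \<Phi> s" if "0 \<le> s" "s < 1" for s
    using w' that by auto
  have anti: "\<Phi> t \<le> \<Phi> s" if "0 \<le> s" "s \<le> t" "t < 1" for s t
    using w' that by (auto simp: monotone_on_def)
  obtain y where y: "y \<in> ball x0 1 - cball x0 (1/2)" "\<phi> y \<noteq> 0"
    using w' by blast
  have "0 < \<Phi> (dist y x0)"
    using y rad[of y] nonneg[of "dist y x0"] by (auto simp: dist_commute less_le)
  also have "\<dots> \<le> \<Phi> (1/2)"
    using y by (intro anti) (auto simp: dist_commute)
  finally show "0 < \<Phi> (1/2)" .
  show "\<Phi> (1/2) \<le> \<Phi> 0"
    by (intro anti) auto
  show "0 \<le> \<phi> x \<and> \<phi> x \<le> \<Phi> 0" if "x \<in> ball x0 1" for x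
    using that by (auto simp: rad dist_commute intro: nonneg anti)
  show "\<Phi> (1/2) \<le> \<phi> x" if "x \<in> ball x0 (1/2)" for x
  proof -
    have "x \<in> ball x0 1" using that by auto
    then show ?thesis
      using that by (auto simp: rad dist_commute intro: anti)
  qed
qed

lemma radially_decreasing_weight_measurable:
  assumes w: "radially_decreasing_weight x0 \<phi> \<Phi>" and borel: "sets \<mu> = sets borel"
  shows "(\<lambda>x. \<phi> x * indicator (ball x0 1) x) \<in> borel_measurable \<mu>"
proof -
  note w' = w[unfolded radially_decreasing_weight_def]
  define \<Psi> where "\<Psi> s = (if s < 1 then - \<Phi> (max 0 s) else 0)" for s
  have "mono \<Psi>"
    using w' by (auto simp: mono_def \<Psi>_def monotone_on_def)
  then have [measurable]: "\<Psi> \<in> borel_measurable borel"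
    by (rule borel_measurable_mono)
  have [measurable]: "(\<lambda>x. dist x x0) \<in> borel_measurable borel"
    by (intro borel_measurable_continuous_onI continuous_intros)
  have "(\<lambda>x. - \<Psi> (dist x x0)) \<in> borel_measurable borel"
    by measurable
  moreover have "\<phi> x * indicator (ball x0 1) x = - \<Psi> (dist x x0)" for x
    using w' by (auto simp: \<Psi>_def dist_commute indicator_def)
  ultimately show ?thesis
    by (simp add: measurable_cong_sets[OF borel refl])
qed

lemma weight_le_layers:
  assumes w: "radially_decreasing_weight x0 \<phi> \<Phi>" and rep: "representing_measure x0 \<phi> \<Phi> \<nu>"
    and x: "x \<in> ball x0 1"
  shows "ennreal (\<phi> x) \<le> ennreal (\<Phi> 0 / \<Phi> (1/2)) * (\<integral>\<^sup>+t. indicator (ball x0 t) x \<partial>\<nu>)"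
proof -
  note bounds = radially_decreasing_weight_bounds[OF w]
  have sp: "space \<nu> = {1/2<..1}"
    using rep sets_eq_imp_space_eq[of \<nu> "restrict_space borel {1/2<..1}"]
    by (simp add: representing_measure_def)
  show ?thesis
  proof (cases "x \<in> cball x0 (1/2)")
    case True
    have "(\<integral>\<^sup>+t. indicator (ball x0 t) x \<partial>\<nu>) = (\<integral>\<^sup>+t. 1 \<partial>\<nu>)"
      using True by (intro nn_integral_cong) (auto simp: sp)
    also have "\<dots> = ennreal (\<Phi> (1/2))"
      using rep by (simp add: sp representing_measure_def)
    finally have "ennreal (\<Phi> 0 / \<Phi> (1/2)) * (\<integral>\<^sup>+t. indicator (ball x0 t) x \<partial>\<nu>) = ennreal (\<Phi> 0)"
      using bounds(3,4) by (simp add: ennreal_mult[symmetric])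
    then show ?thesis
      using bounds(1)[OF x] by (simp add: ennreal_leI)
  next
    case False
    then have "ennreal (\<phi> x) = (\<integral>\<^sup>+t. indicator (ball x0 t) x \<partial>\<nu>)"
      using x by (intro representing_measure_indicator[OF rep]) auto
    moreover have "1 \<le> ennreal (\<Phi> 0 / \<Phi> (1/2))"
      using bounds(3,4) by (simp add: ennreal_ge_1)
    ultimately show ?thesis
      using mult_right_mono[of 1 "ennreal (\<Phi> 0 / \<Phi> (1/2))" "ennreal (\<phi> x)"] by simp
  qed
qed

theorem theorem1:
  fixes \<mu> :: "'a::metric_space measure"
    and x0 :: 'a
    and p :: real
    and \<phi> :: "'a \<Rightarrow> real"
    and \<Phi> :: "real \<Rightarrow> real"
    and \<nu> :: "real measure"
    and F :: "('a \<Rightarrow> real) \<Rightarrow> real \<Rightarrow> ennreal"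
  assumes borel: "sets \<mu> = sets borel"
    and sigma_finite: "sigma_finite_measure \<mu>"
    and ball_half_pos: "0 < emeasure \<mu> (ball x0 (1/2))"
    and ball_one_finite: "emeasure \<mu> (ball x0 1) < \<infinity>"
    and p_ge_1: "1 \<le> p"
    and weight: "radially_decreasing_weight x0 \<phi> \<Phi>"
    and representing: "representing_measure x0 \<phi> \<Phi> \<nu>"
    and F_shift: "\<And>u a r. u \<in> Lp_on \<mu> p UNIV \<Longrightarrow> (\<lambda>x. u x + a) \<in> Lp_on \<mu> p UNIV \<Longrightarrow>
        r \<in> {1/2<..1} \<Longrightarrow> F (\<lambda>x. u x + a) r = F u r"
    and F_poincare: "\<And>u r. u \<in> Lp_on \<mu> p UNIV \<Longrightarrow> r \<in> {1/2<..1} \<Longrightarrow>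
        (\<integral>\<^sup>+x\<in>ball x0 r. ennreal (\<bar>u x - mean_on \<mu> (ball x0 r) u\<bar> powr p) \<partial>\<mu>) \<le> F u r"
  shows "\<forall>u\<in>Lp_on \<mu> p (ball x0 1). \<forall>v\<in>Lp_on \<mu> p UNIV.
      (AE x in \<mu>. x \<in> ball x0 1 \<longrightarrow> v x = u x) \<longrightarrow>
      (\<integral>\<^sup>+x\<in>ball x0 1.
          ennreal (\<bar>u x - weighted_mean_on \<mu> \<phi> (ball x0 1) u\<bar> powr p * \<phi> x) \<partial>\<mu>)
      \<le> ennreal (8 powr p * measure \<mu> (ball x0 1) / measure \<mu> (ball x0 (1/2)) * (\<Phi> 0 / \<Phi> (1/2)))
        * (\<integral>\<^sup>+t. F v t \<partial>\<nu>)"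
proof (intro ballI impI)
  fix u v
  assume u: "u \<in> Lp_on \<mu> p (ball x0 1)" and v: "v \<in> Lp_on \<mu> p UNIV"
    and uv: "AE x in \<mu>. x \<in> ball x0 1 \<longrightarrow> v x = u x"
  note bounds = radially_decreasing_weight_bounds[OF weight]
  define w where "w x = \<phi> x * indicator (ball x0 1) x" for x
  define R where "R = \<Phi> 0 / \<Phi> (1/2)"
  define K where "K = 2 powr p * (measure \<mu> (ball x0 1) / measure \<mu> (ball x0 (1/2)))"
  define c where "c = mean_on \<mu> (ball x0 (1/2)) v"
  define m where "m = (\<integral>x. v x * w x \<partial>\<mu>) / (\<integral>x. w x \<partial>\<mu>)"

  have ball_sets [measurable]: "ball x0 r \<in> sets \<mu>" for r
    by (simp add: borel)
  have w_meas [measurable]: "w \<in> borel_measurable \<mu>"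
    unfolding w_def by (rule radially_decreasing_weight_measurable[OF weight borel])
  have v_meas [measurable]: "v \<in> borel_measurable \<mu>" and vp: "integrable \<mu> (\<lambda>x. \<bar>v x\<bar> powr p)"
    using v by (simp_all add: Lp_on_def set_borel_measurable_def set_integrable_def)
  have u_meas: "(\<lambda>x. u x * indicator (ball x0 1) x) \<in> borel_measurable \<mu>"
    using u by (simp add: Lp_on_def set_borel_measurable_def mult.commute)
  have ball_mono: "emeasure \<mu> (ball x0 r) \<le> emeasure \<mu> (ball x0 1)" if "r \<le> 1" for r
    using that by (intro emeasure_mono subset_ball) auto
  have ball_fin: "emeasure \<mu> (ball x0 r) < \<infinity>" if "r \<le> 1" for r
    using ball_mono[OF that] ball_one_finite by (rule le_less_trans)
  have half_pos: "0 < measure \<mu> (ball x0 (1/2))"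
    using ball_half_pos ball_fin[of "1/2"] by (simp add: measure_def enn2real_positive_iff)
  have one_ge: "measure \<mu> (ball x0 r) \<le> measure \<mu> (ball x0 1)" if "r \<le> 1" for r
    using ball_mono[OF that] ball_one_finite by (simp add: measure_def enn2real_mono)
  have R: "1 \<le> R"
    using bounds(3,4) by (simp add: R_def)
  have K: "0 \<le> K" "0 < K"
    using half_pos one_ge[of "1/2"] by (simp_all add: K_def)

  have w_nonneg: "0 \<le> w x" and w_le: "w x \<le> \<Phi> 0 * indicator (ball x0 1) x"
    and w_ge: "\<Phi> (1/2) * indicator (ball x0 (1/2)) x \<le> w x" for x
    using bounds(1)[of x] bounds(2)[of x] by (auto simp: w_def indicator_def)
  have ind_int: "integrable \<mu> (indicator (ball x0 r) :: 'a \<Rightarrow> real)" if "r \<le> 1" for r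
    using ball_fin[OF that] by simp
  have w_int: "integrable \<mu> w"
    by (rule Bochner_Integration.integrable_bound[OF integrable_mult_right[OF ind_int[of 1], of "\<Phi> 0"]])
      (use w_nonneg w_le order_trans[OF w_nonneg w_le] in \<open>simp_all add: abs_of_nonneg\<close>)
  have vw_int: "integrable \<mu> (\<lambda>x. \<bar>v x\<bar> powr p * w x)"
  proof (rule Bochner_Integration.integrable_bound[OF integrable_mult_left[OF vp, of "\<Phi> 0"]])
    have "w x \<le> \<Phi> 0" for x
      using bounds(1)[of x] bounds(3,4) by (auto simp: w_def indicator_def)
    then show "AE x in \<mu>. norm (\<bar>v x\<bar> powr p * w x) \<le> norm (\<bar>v x\<bar> powr p * \<Phi> 0)"
      using bounds(3,4) by (intro AE_I2) (simp add: abs_mult w_nonneg mult_left_mono)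
  qed simp
  have w_pos: "0 < (\<integral>x. w x \<partial>\<mu>)"
  proof -
    have "0 < \<Phi> (1/2) * measure \<mu> (ball x0 (1/2))"
      using half_pos bounds(3) by simp
    also have "\<dots> = (\<integral>x. \<Phi> (1/2) * indicator (ball x0 (1/2)) x \<partial>\<mu>)"
      by simp
    also have "\<dots> \<le> (\<integral>x. w x \<partial>\<mu>)"
      using ind_int[of "1/2"] by (intro integral_mono w_int w_ge integrable_mult_right) auto
    finally show ?thesis .
  qed

  have layer: "(\<integral>\<^sup>+x\<in>ball x0 t. ennreal (\<bar>v x - c\<bar> powr p) \<partial>\<mu>) \<le> ennreal K * F v t"
    if t: "t \<in> {1/2<..1}" for t
  proof -
    have "(\<integral>\<^sup>+x\<in>ball x0 t. ennreal (\<bar>v x - c\<bar> powr p) \<partial>\<mu>)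
        \<le> ennreal (2 powr p * (measure \<mu> (ball x0 t) / measure \<mu> (ball x0 (1/2))))
          * (\<integral>\<^sup>+x\<in>ball x0 t. ennreal (\<bar>v x - mean_on \<mu> (ball x0 t) v\<bar> powr p) \<partial>\<mu>)"
      unfolding c_def using t half_pos ball_fin[of t]
      by (intro set_oscillation_le[OF p_ge_1 v]) auto
    also have "\<dots> \<le> ennreal K * F v t"
      using t half_pos one_ge[of t] F_poincare[OF v t] unfolding K_def
      by (intro mult_mono ennreal_leI mult_left_mono divide_right_mono) auto
    finally show ?thesis .
  qed

  have osc: "(\<integral>\<^sup>+x. ennreal (\<bar>v x - c\<bar> powr p * w x) \<partial>\<mu>) \<le> ennreal (R * K) * (\<integral>\<^sup>+t. F v t \<partial>\<nu>)"
  proof -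
    have sets_\<nu>: "sets \<nu> = sets (restrict_space borel {1/2<..1})" and "sigma_finite_measure \<nu>"
      using representing by (auto simp: representing_measure_def)
    have sp: "space \<nu> = {1/2<..1}"
      using sets_eq_imp_space_eq[OF sets_\<nu>] by simp
    interpret \<mu>\<nu>: pair_sigma_finite \<mu> \<nu>
      using sigma_finite \<open>sigma_finite_measure \<nu>\<close> by (simp add: pair_sigma_finite_def)
    have [measurable]: "(\<lambda>t. t) \<in> borel_measurable \<nu>"
      by (simp add: measurable_cong_sets[OF sets_\<nu> refl] measurable_restrict_space1)
    have [measurable]: "(\<lambda>x. dist x0 x) \<in> borel_measurable \<mu>"
      by (auto simp: measurable_cong_sets[OF borel refl]
          intro!: borel_measurable_continuous_onI continuous_intros)
    define g where "g x t = ennreal (\<bar>v x - c\<bar> powr p) * indicator (ball x0 t) x" for x t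
    have "(\<lambda>(x, t). if dist x0 x < t then ennreal (\<bar>v x - c\<bar> powr p) else 0)
        \<in> borel_measurable (\<mu> \<Otimes>\<^sub>M \<nu>)"
      by measurable
    also have "(\<lambda>(x, t). if dist x0 x < t then ennreal (\<bar>v x - c\<bar> powr p) else 0) = case_prod g"
      by (auto simp: g_def indicator_def fun_eq_iff)
    finally have g_meas [measurable]: "case_prod g \<in> borel_measurable (\<mu> \<Otimes>\<^sub>M \<nu>)" .
    have "(\<integral>\<^sup>+x. ennreal (\<bar>v x - c\<bar> powr p * w x) \<partial>\<mu>)
        \<le> (\<integral>\<^sup>+x. ennreal R * (\<integral>\<^sup>+t. g x t \<partial>\<nu>) \<partial>\<mu>)"
    proof (rule nn_integral_mono)
      fix x assume "x \<in> space \<mu>"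
      have "(\<lambda>t. indicator (ball x0 t) x) = (\<lambda>t. if dist x0 x < t then 1 else 0 :: ennreal)"
        by (auto simp: fun_eq_iff indicator_def)
      then have "(\<lambda>t. indicator (ball x0 t) x :: ennreal) \<in> borel_measurable \<nu>"
        by simp
      then have "ennreal R * (\<integral>\<^sup>+t. g x t \<partial>\<nu>)
          = ennreal (\<bar>v x - c\<bar> powr p) * (ennreal R * (\<integral>\<^sup>+t. indicator (ball x0 t) x \<partial>\<nu>))"
        by (simp add: g_def nn_integral_cmult mult.left_commute)
      moreover have "ennreal (w x) \<le> ennreal R * (\<integral>\<^sup>+t. indicator (ball x0 t) x \<partial>\<nu>)"
        using weight_le_layers[OF weight representing, of x] by (cases "x \<in> ball x0 1") (auto simp: w_def R_def)
      ultimately show "ennreal (\<bar>v x - c\<bar> powr p * w x) \<le> ennreal R * (\<integral>\<^sup>+t. g x t \<partial>\<nu>)"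
        by (simp add: ennreal_mult w_nonneg mult_left_mono)
    qed
    also have "\<dots> = ennreal R * (\<integral>\<^sup>+t. (\<integral>\<^sup>+x. g x t \<partial>\<mu>) \<partial>\<nu>)"
      by (simp add: nn_integral_cmult \<mu>\<nu>.Fubini')
    \<comment> \<open>\<open>F v\<close> need not be measurable, so the constant is pulled out on the measurable side.\<close>
    also have "(\<integral>\<^sup>+t. (\<integral>\<^sup>+x. g x t \<partial>\<mu>) \<partial>\<nu>)
        = ennreal K * (\<integral>\<^sup>+t. ennreal (1 / K) * (\<integral>\<^sup>+x. g x t \<partial>\<mu>) \<partial>\<nu>)"
    proof -
      have "ennreal K * ennreal (1 / K) = 1"
        using K by (simp add: ennreal_mult[symmetric])
      then show ?thesis
        by (simp add: nn_integral_cmult mult.assoc[symmetric])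
    qed
    also have "(\<integral>\<^sup>+t. ennreal (1 / K) * (\<integral>\<^sup>+x. g x t \<partial>\<mu>) \<partial>\<nu>) \<le> (\<integral>\<^sup>+t. F v t \<partial>\<nu>)"
    proof (rule nn_integral_mono)
      fix t assume "t \<in> space \<nu>"
      then have "(\<integral>\<^sup>+x. g x t \<partial>\<mu>) \<le> ennreal K * F v t"
        unfolding g_def by (intro layer) (simp add: sp)
      then have "ennreal (1 / K) * (\<integral>\<^sup>+x. g x t \<partial>\<mu>) \<le> ennreal (1 / K) * (ennreal K * F v t)"
        by (rule mult_left_mono) simp
      also have "\<dots> = F v t"
        using K by (simp add: mult.assoc[symmetric] ennreal_mult[symmetric])
      finally show "ennreal (1 / K) * (\<integral>\<^sup>+x. g x t \<partial>\<mu>) \<le> F v t" .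
    qed
    finally show ?thesis
      using R K by (simp add: ennreal_mult mult.assoc mult_left_mono)
  qed

  have "weighted_mean_on \<mu> \<phi> (ball x0 1) u = m"
  proof -
    have "(LINT x:ball x0 1|\<mu>. u x * \<phi> x) = (\<integral>x. (u x * indicator (ball x0 1) x) * w x \<partial>\<mu>)"
      unfolding set_lebesgue_integral_def
      by (intro Bochner_Integration.integral_cong) (auto simp: w_def indicator_def)
    also have "\<dots> = (\<integral>x. v x * w x \<partial>\<mu>)"
      using uv by (intro integral_cong_AE borel_measurable_times u_meas v_meas w_meas)
        (auto elim!: eventually_mono simp: w_def indicator_def)
    finally show ?thesis
      by (simp add: weighted_mean_on_def m_def w_def set_lebesgue_integral_def mult.commute)
  qed
  then have "(\<integral>\<^sup>+x\<in>ball x0 1.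
      ennreal (\<bar>u x - weighted_mean_on \<mu> \<phi> (ball x0 1) u\<bar> powr p * \<phi> x) \<partial>\<mu>)
      = (\<integral>\<^sup>+x. ennreal (\<bar>v x - m\<bar> powr p * w x) \<partial>\<mu>)"
    using uv by (intro nn_integral_cong_AE) (auto elim!: eventually_mono simp: w_def indicator_def)
  also have "\<dots> \<le> ennreal (2 powr p) * (\<integral>\<^sup>+x. ennreal (\<bar>v x - c\<bar> powr p * w x) \<partial>\<mu>)"
  proof -
    note int = integrable_diff_powr_weighted[OF p_ge_1 v_meas w_meas w_nonneg w_int vw_int]
    have "(\<integral>x. \<bar>v x - m\<bar> powr p * w x \<partial>\<mu>) \<le> 2 powr p * (\<integral>x. \<bar>v x - c\<bar> powr p * w x \<partial>\<mu>)"
      using weighted_oscillation_le[OF p_ge_1 v_meas w_meas w_meas w_nonneg order_refl w_int vw_int w_pos, of c]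
        w_pos by (simp add: m_def)
    then show ?thesis
      by (simp add: nn_integral_eq_integral int w_nonneg ennreal_mult[symmetric] ennreal_leI)
  qed
  also have "\<dots> \<le> ennreal (2 powr p) * (ennreal (R * K) * (\<integral>\<^sup>+t. F v t \<partial>\<nu>))"
    by (intro mult_left_mono osc) simp
  also have "\<dots> = ennreal (2 powr p * (R * K)) * (\<integral>\<^sup>+t. F v t \<partial>\<nu>)"
    using R K by (simp add: ennreal_mult mult.assoc)
  also have "2 powr p * (R * K)
      = 4 powr p * measure \<mu> (ball x0 1) / measure \<mu> (ball x0 (1/2)) * (\<Phi> 0 / \<Phi> (1/2))"
    using powr_mult[of 2 2 p] by (simp add: K_def R_def ac_simps)
  also have "ennreal (4 powr p * measure \<mu> (ball x0 1) / measure \<mu> (ball x0 (1/2)) * (\<Phi> 0 / \<Phi> (1/2)))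
      \<le> ennreal (8 powr p * measure \<mu> (ball x0 1) / measure \<mu> (ball x0 (1/2)) * (\<Phi> 0 / \<Phi> (1/2)))"
    using p_ge_1 bounds(3,4)
    by (intro ennreal_leI mult_right_mono divide_right_mono powr_mono2) auto
  finally show "(\<integral>\<^sup>+x\<in>ball x0 1.
          ennreal (\<bar>u x - weighted_mean_on \<mu> \<phi> (ball x0 1) u\<bar> powr p * \<phi> x) \<partial>\<mu>)
      \<le> ennreal (8 powr p * measure \<mu> (ball x0 1) / measure \<mu> (ball x0 (1/2)) * (\<Phi> 0 / \<Phi> (1/2)))
        * (\<integral>\<^sup>+t. F v t \<partial>\<nu>)"
    by (simp add: mult_right_mono)
qed

end
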